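(* Let $A_0=1$ and for $p>0$ let $A_p = (-1)^p + 2\sum_{j=0}^{\lfloor p/2\rfloor}\binom{p}{2j+1}A_{p-2j-1}$; let $B_0=1$ and for $p>0$ let $B_p = 2\sum_{j=0}^{\lfloor p/2\rfloor}\binom{p}{2j+1}B_{p-2j-1}$. For integers $p\ge 0$ and $n \ge 0$ let $\mathcal{C}_n^{(p)} = \sum_{i=0}^{n} i^p F_{n-i}$, where $i^0$ is interpreted as $1$ (also for $i=0$). Then for all integers $p \geq 0$ and $n\ge 0$, \[ \mathcal{C}_n^{(p)} \;=\; A_p F_n + B_p F_{n+1} - \sum_{k=0}^{p} \binom{p}{k} B_k\, n^{p-k}. \]
   Context: $F_n$ denotes the Fibonacci numbers: $F_0=0$, $F_1=1$, $F_n=F_{n-1}+F_{n-2}$ for $n>1$. Binomial coefficients $\binom{p}{m}$ with $m>p$ are $0$, so in the recursive definitions only terms with $2j+1\le p$ contribute. The convention $0^0=1$ is used throughout. *)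

theory Defs
  imports Complex_Main "HOL-Number_Theory.Fib"
begin

text \<open>
  In both recursions the summand with \<open>2 * j + 1 > p\<close> (which occurs exactly for even \<open>p\<close>
  and \<open>j = p div 2\<close>) vanishes because \<open>p choose (2 * j + 1) = 0\<close>; the truncated
  subtraction in its index is therefore harmless.
\<close>

fun A_seq :: "nat \<Rightarrow> int" where
  "A_seq p = (if p = 0 then 1
     else (-1) ^ p + 2 * (\<Sum>j = 0..p div 2. int (p choose (2 * j + 1)) * A_seq (p - 2 * j - 1)))"

fun B_seq :: "nat \<Rightarrow> int" where
  "B_seq p = (if p = 0 then 1
     else 2 * (\<Sum>j = 0..p div 2. int (p choose (2 * j + 1)) * B_seq (p - 2 * j - 1)))"

declare A_seq.simps [simp del] B_seq.simps [simp del]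

definition fib_conv :: "nat \<Rightarrow> nat \<Rightarrow> int" where
  "fib_conv p n = (\<Sum>i = 0..n. int i ^ p * int (fib (n - i)))"

end

theory Submission
  imports Defs "HOL-Computational_Algebra.Formal_Power_Series"
begin

text \<open>
  In terms of exponential generating functions, with \<open>x = exp t\<close> and \<open>y = exp (- t)\<close>, the two
  recursions say \<open>(1 - x + y) A = y\<close> and \<open>(1 - x + y) B = 1\<close>, since \<open>x - y\<close> is twice the series
  of the odd binomial terms. The generating function (in \<open>p\<close>) of the convolutions is
  \<open>C = (\<Sum>i\<le>n. F (n - i) x ^ i)\<close>, and \<open>x y = 1\<close> gives
  \<open>(1 - x + y) C = F n y + F (n + 1) - x ^ n\<close>. Multiplying by \<open>B\<close> yields
  \<open>C = F n A + F (n + 1) B - x ^ n B\<close>, whose coefficients are the claim.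
\<close>

unbundle fps_syntax

text \<open>Real coefficients make room for the factorials; integer identities are recovered through
  \<open>egf_inject\<close>.\<close>

definition egf :: "(nat \<Rightarrow> int) \<Rightarrow> real fps" where
  "egf f = Abs_fps (\<lambda>n. of_int (f n) / fact n)"

lemma egf_nth: "egf f $ n = of_int (f n) / fact n"
  by (simp add: egf_def)

lemma egf_inject: "egf f = egf g \<longleftrightarrow> f = g"
  by (auto simp: fps_eq_iff egf_nth fun_eq_iff)

lemma egf_add: "egf (\<lambda>n. f n + g n) = egf f + egf g"
  by (simp add: fps_eq_iff egf_nth add_divide_distrib)

lemma egf_diff: "egf (\<lambda>n. f n - g n) = egf f - egf g"
  by (simp add: fps_eq_iff egf_nth diff_divide_distrib)

lemma egf_mult_const: "egf (\<lambda>n. f n * c) = egf f * of_int c"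
  by (simp add: fps_eq_iff egf_nth flip: fps_of_int)

lemma egf_sum: "egf (\<lambda>n. \<Sum>i\<in>S. f i n) = (\<Sum>i\<in>S. egf (f i))"
  by (simp add: fps_eq_iff egf_nth fps_sum_nth sum_divide_distrib)

lemma egf_mult:
  "egf f * egf g = egf (\<lambda>n. \<Sum>k = 0..n. int (n choose k) * f k * g (n - k))"
  by (auto simp: fps_eq_iff egf_nth fps_mult_nth sum_divide_distrib binomial_fact
      intro!: sum.cong)

lemma egf_power: "egf (\<lambda>n. c ^ n) = fps_exp (of_int c)"
  by (simp add: fps_eq_iff egf_nth)

lemma egf_delta: "egf (\<lambda>n. if n = 0 then c else 0) = of_int c"
  by (auto simp: fps_eq_iff egf_nth simp flip: fps_of_int)

text \<open>The factor \<open>1 ^ k - (-1) ^ k\<close> is 2 for odd \<open>k\<close> and 0 for even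
  \<open>k\<close>, and its series is a difference of two exponentials.\<close>

lemma sum_odd_binomial:
  fixes f :: "nat \<Rightarrow> int"
  shows "2 * (\<Sum>j = 0..p div 2. int (p choose (2 * j + 1)) * f (p - 2 * j - 1)) =
    (\<Sum>k = 0..p. int (p choose k) * (1 ^ k - (-1) ^ k) * f (p - k))"
proof -
  define h where "h k = int (p choose k) * (1 ^ k - (-1) ^ k) * f (p - k)" for k
  have "2 * (\<Sum>j = 0..p div 2. int (p choose (2 * j + 1)) * f (p - 2 * j - 1)) =
      (\<Sum>j = 0..p div 2. h (2 * j + 1))"
    by (simp add: h_def sum_distrib_left mult_ac)
  also have "\<dots> = sum h ((\<lambda>j. 2 * j + 1) ` {0..p div 2})"
    by (subst sum.reindex) (auto simp: inj_on_def)
  also have "\<dots> = sum h {0..p}"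
  \<comment> \<open>The image may leave \<open>{0..p}\<close>: for even \<open>p\<close> it contains
    \<open>p + 1\<close>, where the binomial coefficient is 0.\<close>
  proof (rule sum.mono_neutral_cong)
    fix k assume "k \<in> {0..p} - (\<lambda>j. 2 * j + 1) ` {0..p div 2}"
    then have "even k"
      by (cases "even k") (force elim!: oddE)+
    then show "h k = 0"
      by (simp add: h_def)
  qed (auto simp: h_def)
  finally show ?thesis
    by (simp add: h_def)
qed

lemma egf_odd_binomial:
  "egf (\<lambda>p. 2 * (\<Sum>j = 0..p div 2. int (p choose (2 * j + 1)) * f (p - 2 * j - 1))) =
    (fps_exp 1 - fps_exp (-1)) * egf f"
proof -
  have "fps_exp 1 - fps_exp (-1) = egf (\<lambda>k. 1 ^ k - (-1) ^ k)"
    by (subst egf_diff) (simp add: egf_power del: power_one)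
  then show ?thesis
    by (simp only: sum_odd_binomial egf_mult)
qed

lemma egf_A_seq: "(1 - fps_exp 1 + fps_exp (-1)) * egf A_seq = fps_exp (-1)"
proof -
  \<comment> \<open>At \<open>p = 0\<close> the sum is 0 because \<open>0 choose 1 = 0\<close>, so
    one formula covers the initial value too.\<close>
  have "A_seq = (\<lambda>p. (-1) ^ p +
      2 * (\<Sum>j = 0..p div 2. int (p choose (2 * j + 1)) * A_seq (p - 2 * j - 1)))"
    by (rule ext, subst A_seq.simps) auto
  from arg_cong[OF this, of egf]
  have "egf A_seq = fps_exp (-1) + (fps_exp 1 - fps_exp (-1)) * egf A_seq"
    by (simp only: egf_add egf_odd_binomial egf_power) simp
  then show ?thesis
    by (simp add: algebra_simps)
qed

lemma egf_B_seq: "(1 - fps_exp 1 + fps_exp (-1)) * egf B_seq = 1"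
proof -
  have "B_seq = (\<lambda>p. (if p = 0 then 1 else 0) +
      2 * (\<Sum>j = 0..p div 2. int (p choose (2 * j + 1)) * B_seq (p - 2 * j - 1)))"
    by (rule ext, subst B_seq.simps) auto
  from arg_cong[OF this, of egf]
  have "egf B_seq = 1 + (fps_exp 1 - fps_exp (-1)) * egf B_seq"
    by (simp only: egf_add egf_odd_binomial egf_delta) simp
  then show ?thesis
    by (simp add: algebra_simps)
qed

lemma sum_power_fib:
  fixes x y :: "'a :: comm_ring_1"
  assumes "x * y = 1"
  shows "(1 - x + y) * (\<Sum>i = 0..n. x ^ i * of_nat (fib (n - i))) =
    y * of_nat (fib n) + of_nat (fib (n + 1)) - x ^ n"
proof (induction n rule: fib.induct)
  case 1
  then show ?case by simp
next
  case 2
  then show ?case by simp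
next
  case (3 n)
  define S where "S m = (\<Sum>i = 0..m. x ^ i * of_nat (fib (m - i)) :: 'a)" for m
  \<comment> \<open>The Fibonacci recursion applies termwise for \<open>i \<le> n\<close>. At
    \<open>i = n + 1\<close> the left has \<open>fib 1 = 1\<close> but \<open>S (Suc n)\<close> has
    \<open>fib 0 = 0\<close>, hence the extra power.\<close>
  have "S (Suc (Suc n)) = S (Suc n) + S n + x ^ Suc n"
    by (simp add: S_def Suc_diff_le algebra_simps sum.distrib)
  moreover have "(1 - x + y) * x ^ Suc n = x ^ Suc n - x ^ Suc (Suc n) + x ^ n"
    using assms by (simp add: algebra_simps flip: mult.assoc)
  ultimately show ?case
    using 3 unfolding S_def[symmetric] by (simp add: algebra_simps)
qed

text \<open>With \<open>n\<close> fixed, \<open>i ^ p\<close> as a sequence in \<open>p\<close> has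
  the series exp(it), the \<open>i\<close>-th power of exp(t); \<open>0 ^ 0 = 1\<close> covers
  \<open>i = 0\<close>.\<close>

lemma egf_fib_conv:
  "egf (\<lambda>p. fib_conv p n) = (\<Sum>i = 0..n. fps_exp 1 ^ i * of_nat (fib (n - i)))"
  by (simp add: fib_conv_def egf_sum egf_mult_const egf_power fps_exp_power_mult)

theorem theorem2:
  fixes p n :: nat
  shows "fib_conv p n =
    A_seq p * int (fib n) + B_seq p * int (fib (n + 1))
      - (\<Sum>k = 0..p. int (p choose k) * B_seq k * int n ^ (p - k))"
proof -
  define x y :: "real fps" where "x = fps_exp 1" and "y = fps_exp (-1)"
  define D where "D = 1 - x + y"
  have DA: "D * egf A_seq = y" and DB: "D * egf B_seq = 1"
    using egf_A_seq egf_B_seq by (simp_all add: D_def x_def y_def)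
  have A: "egf A_seq = y * egf B_seq"
    by (metis DA DB mult.assoc mult.commute mult_1)
  have "x * y = 1"
    by (simp add: x_def y_def flip: fps_exp_add_mult)
  from sum_power_fib[OF this, of n]
  have "D * egf (\<lambda>p. fib_conv p n) = y * of_nat (fib n) + of_nat (fib (n + 1)) - x ^ n"
    by (simp add: D_def egf_fib_conv x_def)
  then have "egf B_seq * (D * egf (\<lambda>p. fib_conv p n)) =
      egf A_seq * of_nat (fib n) + egf B_seq * of_nat (fib (n + 1)) - egf B_seq * x ^ n"
    by (simp only:) (simp add: A algebra_simps)
  \<comment> \<open>\<open>egf B_seq\<close> is the inverse of \<open>D\<close>, so multiplying by
    it replaces division.\<close>
  moreover have "egf B_seq * (D * z) = z" for z
    by (metis DB mult.assoc mult.commute mult_1)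
  moreover have "x ^ n = egf (\<lambda>p. int n ^ p)"
    by (simp add: egf_power x_def fps_exp_power_mult)
  ultimately have "egf (\<lambda>p. fib_conv p n) =
      egf (\<lambda>p. A_seq p * int (fib n) + B_seq p * int (fib (n + 1))
        - (\<Sum>k = 0..p. int (p choose k) * B_seq k * int n ^ (p - k)))"
    by (simp only: egf_diff egf_add egf_mult_const egf_mult of_int_of_nat_eq)
  then show ?thesis
    by (simp add: egf_inject fun_eq_iff)
qed

end
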